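(* Let $S,u\colon \mathbb{Z}_{\ge 0}\to\mathbb{Z}_{\ge 0}$ be functions, and let $\pi_a,\pi_b\colon \mathbb{Z}_{\ge 0}^2\to\mathbb{Z}_{\ge 0}$ be two functions, each weakly decreasing in the second variable, with $\sum_{s=1}^{u(n)}\pi_a(n,s)=\sum_{s=1}^{u(n)}\pi_b(n,s)=S(n)$ for every $n\ge 0$. For each $n\ge 0$ and $\pi\in\{\pi_a,\pi_b\}$ let $A_n(\pi)$ be the set of sequences $(a_1,\dots,a_{u(n)})$ of non-negative integers satisfying $$a_1 \ge_{\pi(n,1)-\pi(n,2)} a_2\ge_{\pi(n,2)-\pi(n,3)} \cdots \ge_{\pi(n,u(n)-1)-\pi(n,u(n))} a_{u(n)}\ge_0 \pi(n,u(n)).$$ Then for each $n\ge 0$ the map $$(a_1,\dots,a_{u(n)})\mapsto(b_1,\dots,b_{u(n)}),\qquad b_s=a_s-\pi_a(n,s)+\pi_b(n,s)\quad (s=1,\dots,u(n)),$$ is a bijection from $A_n(\pi_a)$ onto $A_n(\pi_b)$. Consequently these maps give a bijection between the sets of partitions corresponding, for the generating function $\sum_{n=0}^\infty q^{S(n)}/(q)_{u(n)}$, to the choices $\pi_a$ and $\pi_b$, i.e. between the set of pairs $(n,\lambda)$ with $n\ge 0$, $\lambda\in A_n(\pi_a)$ and the set of pairs $(n,\mu)$ with $n\ge 0$, $\mu\in A_n(\pi_b)$.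
   Context: For $n\in\mathbb{Z}$, $(q)_n:=\prod_{s=1}^n(1-q^s)$ if $n>0$ and $(q)_n:=1$ if $n\le 0$. For non-negative integers $a,b,r$, the notation $a\ge_r b$ means $a-b\ge r$. A chain of such relations means that all the relations between consecutive terms hold; for $u(n)=1$ the chain is just $a_1\ge \pi(n,1)$, and for $u(n)=0$ the set $A_n(\pi)$ consists of the empty sequence only. *)

theory Defs
  imports Complex_Main "HOL-Library.FuncSet"
begin

definition ge_by :: "nat \<Rightarrow> int \<Rightarrow> int \<Rightarrow> bool" where
  "ge_by r a b \<longleftrightarrow> a - b \<ge> int r"

(* A sequence (a_1, ..., a_k) is an extensional function on {1..k}. Its entries are integers
   constrained to be non-negative, so that differences of entries are never truncated.
   The subtraction in ge_by is on nat; it is exact whenever p n is weakly decreasing.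
   For u n = 0 the set consists of exactly one element, the empty sequence. *)
definition part_seqs :: "(nat \<Rightarrow> nat) \<Rightarrow> (nat \<Rightarrow> nat \<Rightarrow> nat) \<Rightarrow> nat \<Rightarrow> (nat \<Rightarrow> int) set" where
  "part_seqs u p n =
     {a \<in> {1..u n} \<rightarrow>\<^sub>E {0..}.
        (\<forall>s\<in>{1..<u n}. ge_by (p n s - p n (s + 1)) (a s) (a (s + 1))) \<and>
        (u n \<ge> 1 \<longrightarrow> ge_by 0 (a (u n)) (int (p n (u n))))}"

definition shift_seq ::
  "(nat \<Rightarrow> nat) \<Rightarrow> (nat \<Rightarrow> nat \<Rightarrow> nat) \<Rightarrow> (nat \<Rightarrow> nat \<Rightarrow> nat) \<Rightarrow> nat \<Rightarrow> (nat \<Rightarrow> int) \<Rightarrow> (nat \<Rightarrow> int)" where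
  "shift_seq u p p' n a = (\<lambda>s\<in>{1..u n}. a s - int (p n s) + int (p' n s))"

end

(* The differences a s - p n s are a weakly decreasing sequence of non-negative integers, and this
   property characterises membership in part_seqs; the shift preserves these differences while
   replacing p by p'. The inverse of the shift is the shift with p and p' interchanged. *)
theory Submission
  imports Defs
begin

text \<open>Telescoping: the gap conditions from \<open>s\<close> up to \<open>u n\<close> bound
  \<open>a s - a (u n)\<close> below by \<open>p n s - p n (u n)\<close>, and the condition on the
  last entry supplies the rest. Hence the induction descends from \<open>u n\<close>.\<close>

lemma part_seqs_ge:
  assumes "antimono (p n)" "a \<in> part_seqs u p n" "s \<in> {1..u n}"
  shows "int (p n s) \<le> a s"
proof -
  have "s \<le> u n" using assms(3) by simp
  then show ?thesis
  proof (induction s rule: inc_induct)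
    case base
    then show ?case using assms by (auto simp: part_seqs_def ge_by_def)
  next
    case (step k)
    \<comment> \<open>The induction only visits indices with \<open>s \<le> k\<close>, so
      \<open>k\<close> is at least 1 and the gap condition applies.\<close>
    have "k \<in> {1..<u n}" using step.hyps assms(3) by auto
    then have "int (p n k - p n (k + 1)) \<le> a k - a (k + 1)"
      using assms(2) by (auto simp: part_seqs_def ge_by_def)
    moreover have "p n (k + 1) \<le> p n k" using assms(1) by (simp add: antimonoD)
    ultimately show ?case using step.IH by (simp add: of_nat_diff)
  qed
qed

lemma shift_seq_in_part_seqs:
  assumes "antimono (p n)" "antimono (p' n)" "a \<in> part_seqs u p n"
  shows "shift_seq u p p' n a \<in> part_seqs u p' n"
proof -
  have nonneg: "0 \<le> a s - int (p n s) + int (p' n s)" if "s \<in> {1..u n}" for s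
    using part_seqs_ge[OF assms(1,3) that] by simp
  have gap: "ge_by (p' n s - p' n (s + 1)) (shift_seq u p p' n a s) (shift_seq u p p' n a (s + 1))"
    if s: "s \<in> {1..<u n}" for s
  proof -
    have "int (p n s - p n (s + 1)) \<le> a s - a (s + 1)"
      using assms(3) s by (auto simp: part_seqs_def ge_by_def)
    \<comment> \<open>Monotonicity makes both \<open>nat\<close> subtractions exact, so the gap of
      the shifted sequence exceeds its bound by the same slack as before.\<close>
    moreover have "p n (s + 1) \<le> p n s" "p' n (s + 1) \<le> p' n s"
      using assms(1,2) by (simp_all add: antimonoD)
    ultimately show ?thesis using s by (simp add: ge_by_def shift_seq_def of_nat_diff)
  qed
  have last: "ge_by 0 (shift_seq u p p' n a (u n)) (int (p' n (u n)))" if "u n \<ge> 1"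
    using part_seqs_ge[OF assms(1,3), of "u n"] that by (simp add: ge_by_def shift_seq_def)
  show ?thesis
    using nonneg gap last by (auto simp: part_seqs_def shift_seq_def)
qed

text \<open>On \<open>{1..u n}\<close> the two shifts cancel; elsewhere both sides are
  \<open>undefined\<close>, since \<open>a\<close> is extensional.\<close>

lemma shift_seq_inverse:
  assumes "a \<in> part_seqs u p n"
  shows "shift_seq u p' p n (shift_seq u p p' n a) = a"
  using assms by (auto simp: part_seqs_def shift_seq_def PiE_def extensional_def fun_eq_iff)

lemma bij_betw_shift_seq:
  assumes "antimono (p n)" "antimono (p' n)"
  shows "bij_betw (shift_seq u p p' n) (part_seqs u p n) (part_seqs u p' n)"
  by (rule bij_betw_byWitness[where f' = "shift_seq u p' p n"])
    (auto simp: shift_seq_inverse intro: shift_seq_in_part_seqs assms)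

text \<open>The index is carried along, so images of different fibres cannot collide and each fibre
  is covered by its own map.\<close>

lemma bij_betw_Sigma_fibrewise:
  assumes "\<And>i. i \<in> I \<Longrightarrow> bij_betw (f i) (A i) (B i)"
  shows "bij_betw (\<lambda>(i, x). (i, f i x)) (Sigma I A) (Sigma I B)"
proof (rule bij_betw_imageI)
  show "inj_on (\<lambda>(i, x). (i, f i x)) (Sigma I A)"
    using assms by (auto simp: inj_on_def bij_betw_def)
  show "(\<lambda>(i, x). (i, f i x)) ` Sigma I A = Sigma I B"
    using assms by (force simp: bij_betw_def image_iff)
qed

theorem mainTheorem3:
  fixes S u :: "nat \<Rightarrow> nat"
    and \<pi>\<^sub>a \<pi>\<^sub>b :: "nat \<Rightarrow> nat \<Rightarrow> nat"
  assumes "\<And>n. antimono (\<pi>\<^sub>a n)"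
    and "\<And>n. antimono (\<pi>\<^sub>b n)"
    and "\<And>n. (\<Sum>s=1..u n. \<pi>\<^sub>a n s) = S n"
    and "\<And>n. (\<Sum>s=1..u n. \<pi>\<^sub>b n s) = S n"
  shows "(\<forall>n. bij_betw (shift_seq u \<pi>\<^sub>a \<pi>\<^sub>b n) (part_seqs u \<pi>\<^sub>a n) (part_seqs u \<pi>\<^sub>b n)) \<and>
         bij_betw (\<lambda>(n, a). (n, shift_seq u \<pi>\<^sub>a \<pi>\<^sub>b n a))
           (SIGMA n:UNIV. part_seqs u \<pi>\<^sub>a n) (SIGMA n:UNIV. part_seqs u \<pi>\<^sub>b n)"
  using bij_betw_shift_seq[OF assms(1,2)] by (simp add: bij_betw_Sigma_fibrewise)

end
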